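(* For all $n\ge1$, $R_{0,2n}=R_{n,2n}=(n!)^2$; that is, the number of permutations $\sigma\in\mathcal{S}_{2n}$ with $\overleftarrow{des}_E(\sigma)=0$ and the number with $\overleftarrow{des}_E(\sigma)=n$ both equal $(n!)^2$.
   Context: $\mathcal{S}_m$ denotes the set of permutations $\sigma=\sigma_1\cdots\sigma_m$ of $\{1,\dots,m\}$. $\overleftarrow{des}_E(\sigma)$ is the number of indices $i\in\{1,\dots,m-1\}$ with $\sigma_i>\sigma_{i+1}$ and $\sigma_i$ even. $R_{k,m}$ denotes the number of $\sigma\in\mathcal{S}_m$ with $\overleftarrow{des}_E(\sigma)=k$. *)

theory Defs
  imports "HOL-Combinatorics.Combinatorics"
begin

text \<open>Permutations are words in one-line notation; list positions start at 0, so
  \<open>xs ! i\<close> is the letter $\sigma_{i+1}$.\<close>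

definition des_E :: "nat list \<Rightarrow> nat" where
  "des_E xs = card {i. Suc i < length xs \<and> xs ! i > xs ! Suc i \<and> even (xs ! i)}"

definition R :: "nat \<Rightarrow> nat \<Rightarrow> nat" where
  "R k m = card {xs \<in> permutations_of_set {1..m}. des_E xs = k}"

end

theory Submission
  imports Defs
begin

text \<open>A word has no even descent top iff every even letter is followed by a larger letter or by
  the end of the word, and it has the maximal number of them iff every even letter is followed by
  a smaller letter. With a sentinel \<open>z\<close> larger than all letters appended, these are the
  conditions that every even letter \<open>x\<close> with successor \<open>y\<close> satisfies
  \<open>x < y\<close> (respectively \<open>x > y\<close>). Build the words by inserting letters in decreasing
  (respectively increasing) order. The new letter may be put exactly at the front or after an odd
  letter, except that an even letter must not be put last in the second case, where the last letter is
  always odd. So the number of admissible slots depends only on the number of odd letters present,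
  and it takes each of the values \<open>1, \<dots>, n\<close> twice.\<close>

abbreviation even_steps :: "(nat \<Rightarrow> nat \<Rightarrow> bool) \<Rightarrow> nat list \<Rightarrow> bool" where
  "even_steps r \<equiv> successively (\<lambda>x y. even x \<longrightarrow> r x y)"

text \<open>With \<open>z\<close> above all of \<open>A\<close>, taking \<open>(<)\<close> for
  \<open>r\<close> gives the words without even descent tops and \<open>(>)\<close> those in which
  every even letter is one, so one recurrence serves both.\<close>

definition even_step_words :: "(nat \<Rightarrow> nat \<Rightarrow> bool) \<Rightarrow> nat \<Rightarrow> nat set \<Rightarrow> nat list set" where
  "even_step_words r z A = {xs \<in> permutations_of_set A. even_steps r (xs @ [z])}"

section \<open>Inserting a letter into a word\<close>

definition insert_nth :: "nat \<Rightarrow> 'a \<Rightarrow> 'a list \<Rightarrow> 'a list" where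
  "insert_nth i a xs = take i xs @ a # drop i xs"

lemma remove1_insert_nth: "a \<notin> set xs \<Longrightarrow> remove1 a (insert_nth i a xs) = xs"
  by (auto simp: insert_nth_def remove1_append dest: in_set_takeD)

text \<open>The index is the length of the stretch before the only occurrence of
  \<open>a\<close>.\<close>

lemma insert_nth_index_unique:
  assumes "a \<notin> set xs" "i \<le> length xs" "j \<le> length xs"
    and "insert_nth i a xs = insert_nth j a xs"
  shows "i = j"
proof -
  have "takeWhile (\<lambda>x. x \<noteq> a) (insert_nth k a xs) = take k xs" for k
    using assms(1) unfolding insert_nth_def
    by (subst takeWhile_append2) (auto dest: in_set_takeD)
  then have "take i xs = take j xs"
    using assms(4) by metis
  then have "length (take i xs) = length (take j xs)"
    by simp
  then show ?thesis
    using assms(2,3) by simp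
qed

section \<open>Admissible slots and their number\<close>

definition slots :: "(nat \<Rightarrow> nat \<Rightarrow> bool) \<Rightarrow> nat \<Rightarrow> nat \<Rightarrow> nat list \<Rightarrow> nat set" where
  "slots r z a xs = {i. i \<le> length xs \<and> (i = 0 \<or> odd (xs ! (i - 1))) \<and>
     (i < length xs \<or> odd a \<or> r a z)}"

text \<open>No letter is \<open>r\<close>-related to \<open>a\<close>, so \<open>a\<close> cannot
  follow an even letter; behind an odd one, the step broken by the insertion carried no condition.
  Since \<open>a\<close> is related to every letter, its own step can fail only against
  \<open>z\<close>.\<close>

lemma even_steps_insert_nth:
  assumes "\<And>x. x \<in> set xs \<Longrightarrow> \<not> r x a" "\<And>x. x \<in> set xs \<Longrightarrow> r a x" "i \<le> length xs"
  shows "even_steps r (insert_nth i a xs @ [z]) \<longleftrightarrow>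
    even_steps r (xs @ [z]) \<and> i \<in> slots r z a xs"
proof -
  define us vs where "us = take i xs" and "vs = drop i xs"
  have xs: "xs = us @ vs"
    by (simp add: us_def vs_def)
  have snoc: "xs @ [z] = us @ vs @ [z]" "insert_nth i a xs @ [z] = us @ a # vs @ [z]"
    by (simp_all add: us_def vs_def insert_nth_def)
  have i: "i = length us"
    using assms(3) by (simp add: us_def)
  have slot: "i \<in> slots r z a xs \<longleftrightarrow>
      (us = [] \<or> odd (last us)) \<and> (vs \<noteq> [] \<or> odd a \<or> r a z)"
    unfolding slots_def xs i by (cases us rule: rev_cases) (auto simp: nth_append)
  have "even_steps r (us @ a # vs @ [z]) \<longleftrightarrow>
      even_steps r us \<and> (us = [] \<or> odd (last us)) \<and> (even a \<longrightarrow> r a (hd (vs @ [z]))) \<and>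
      even_steps r (vs @ [z])"
    using assms(1) last_in_set[of us]
    by (cases "vs @ [z]") (auto simp: successively_append_iff xs)
  moreover have "even_steps r (us @ vs @ [z]) \<longleftrightarrow>
      even_steps r us \<and> (us = [] \<or> (even (last us) \<longrightarrow> r (last us) (hd (vs @ [z])))) \<and>
      even_steps r (vs @ [z])"
    by (subst successively_append_iff) auto
  moreover have "(even a \<longrightarrow> r a (hd (vs @ [z]))) \<longleftrightarrow> vs \<noteq> [] \<or> odd a \<or> r a z"
    using assms(2) by (cases vs) (auto simp: xs)
  ultimately show ?thesis
    unfolding slot snoc by blast
qed

lemma card_nth_filter:
  assumes "distinct xs"
  shows "card {i. i < length xs \<and> P (xs ! i)} = card {x \<in> set xs. P x}"
proof -
  have "{x \<in> set xs. P x} = (!) xs ` {i. i < length xs \<and> P (xs ! i)}"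
    by (auto simp: in_set_conv_nth)
  moreover have "inj_on ((!) xs) {i. i < length xs \<and> P (xs ! i)}"
    using assms by (auto simp: inj_on_def nth_eq_iff_index_eq)
  ultimately show ?thesis
    by (simp add: card_image)
qed

text \<open>The candidates are the front and the places behind odd letters. If the end is closed to
  \<open>a\<close>, the third hypothesis makes the word empty or its last letter odd, so the end is
  a candidate and exactly one slot is lost.\<close>

lemma card_slots:
  assumes "distinct xs" "even_steps r (xs @ [z])"
    and "\<And>x. even a \<Longrightarrow> \<not> r a z \<Longrightarrow> x \<in> set xs \<Longrightarrow> \<not> r x z"
  shows "card (slots r z a xs) =
    card {x \<in> set xs. odd x} + (if odd a \<or> r a z then 1 else 0)"
proof -
  define S where "S = {i. i \<le> length xs \<and> (i = 0 \<or> odd (xs ! (i - 1)))}"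
  \<comment> \<open>The slot behind the letter at index \<open>i\<close> is \<open>Suc i\<close>;
    the extra 0 is the front.\<close>
  have S: "S = insert 0 (Suc ` {i. i < length xs \<and> odd (xs ! i)})"
  proof (rule set_eqI)
    fix i show "i \<in> S \<longleftrightarrow> i \<in> insert 0 (Suc ` {i. i < length xs \<and> odd (xs ! i)})"
      by (cases i) (auto simp: S_def)
  qed
  have "card S = Suc (card {x \<in> set xs. odd x})"
    unfolding S using card_nth_filter[OF assms(1), of odd]
    by (subst card_insert_disjoint) (auto simp: card_image)
  show ?thesis
  proof (cases "odd a \<or> r a z")
    case True
    then have "slots r z a xs = S"
      by (auto simp: slots_def S_def)
    with True \<open>card S = _\<close> show ?thesis by simp
  next
    case False
    have "length xs \<in> S"
    proof (cases xs rule: rev_cases)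
      case (snoc ys y)
      with assms(2) have "even y \<longrightarrow> r y z"
        by (simp add: successively_append_iff)
      with assms(3)[of y] False snoc show ?thesis
        by (auto simp: S_def)
    qed (simp add: S_def)
    moreover have "slots r z a xs = S - {length xs}"
      using False by (auto simp: slots_def S_def)
    ultimately show ?thesis
      using False \<open>card S = _\<close> by simp
  qed
qed

section \<open>Recurrence for inserting an extreme letter\<close>

lemma permutations_of_set_insert_nth:
  assumes "a \<notin> A"
  shows "ys \<in> permutations_of_set (insert a A) \<longleftrightarrow>
    (\<exists>xs \<in> permutations_of_set A. \<exists>i \<le> length xs. ys = insert_nth i a xs)"
proof
  assume ys: "ys \<in> permutations_of_set (insert a A)"
  then obtain us vs where uv: "ys = us @ a # vs"
    by (metis insertI1 permutations_of_setD(1) split_list)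
  have "us @ vs \<in> permutations_of_set A"
    using ys assms by (auto simp: permutations_of_set_def uv)
  moreover have "ys = insert_nth (length us) a (us @ vs)"
    by (simp add: insert_nth_def uv)
  ultimately show "\<exists>xs \<in> permutations_of_set A. \<exists>i \<le> length xs. ys = insert_nth i a xs"
    by (metis le_add1 length_append)
next
  assume "\<exists>xs \<in> permutations_of_set A. \<exists>i \<le> length xs. ys = insert_nth i a xs"
  then obtain xs i where xs: "set xs = A" "distinct xs" and ys: "ys = insert_nth i a xs"
    by (auto simp: permutations_of_set_def)
  have "mset ys = add_mset a (mset (take i xs @ drop i xs))"
    unfolding ys insert_nth_def mset_append by simp
  then have "mset ys = mset (a # xs)"
    by simp
  then have "set ys = set (a # xs)" "distinct ys = distinct (a # xs)"
    by (rule mset_eq_setD, rule mset_eq_imp_distinct_iff)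
  then show "ys \<in> permutations_of_set (insert a A)"
    using xs assms by (simp add: permutations_of_set_def)
qed

text \<open>Insertion is a bijection from pairs of a word on \<open>A\<close> and a slot onto the
  words on \<open>insert a A\<close>. All words have equally many slots, so the count is a
  product.\<close>

lemma card_even_step_words_insert:
  assumes "finite A" "a \<notin> A"
    and "\<And>x. x \<in> A \<Longrightarrow> \<not> r x a" "\<And>x. x \<in> A \<Longrightarrow> r a x"
    and "\<And>x. even a \<Longrightarrow> \<not> r a z \<Longrightarrow> x \<in> A \<Longrightarrow> \<not> r x z"
  shows "card (even_step_words r z (insert a A)) =
    (card {x \<in> A. odd x} + (if odd a \<or> r a z then 1 else 0)) * card (even_step_words r z A)"
proof -
  let ?W = "even_step_words r z"
  let ?D = "SIGMA xs:?W A. slots r z a xs"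
  have W: "set xs = A" "distinct xs" "even_steps r (xs @ [z])" if "xs \<in> ?W A" for xs
    using that by (auto simp: even_step_words_def permutations_of_set_def)
  have step: "even_steps r (insert_nth i a xs @ [z]) \<longleftrightarrow>
      even_steps r (xs @ [z]) \<and> i \<in> slots r z a xs"
    if "xs \<in> permutations_of_set A" "i \<le> length xs" for xs i
    using that assms(3,4) by (intro even_steps_insert_nth) (auto simp: permutations_of_set_def)
  have le: "i \<le> length xs" if "i \<in> slots r z a xs" for i xs
    using that by (simp add: slots_def)
  have "?W (insert a A) = (\<lambda>(xs, i). insert_nth i a xs) ` ?D"
  proof (intro equalityI subsetI)
    fix ys assume "ys \<in> ?W (insert a A)"
    then obtain xs i where "xs \<in> permutations_of_set A" "i \<le> length xs"
      "ys = insert_nth i a xs" "even_steps r (ys @ [z])"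
      by (auto simp: even_step_words_def permutations_of_set_insert_nth[OF assms(2)])
    with step show "ys \<in> (\<lambda>(xs, i). insert_nth i a xs) ` ?D"
      by (force simp: even_step_words_def)
  next
    fix ys assume "ys \<in> (\<lambda>(xs, i). insert_nth i a xs) ` ?D"
    then obtain xs i where xs: "xs \<in> permutations_of_set A" "even_steps r (xs @ [z])"
      and i: "i \<in> slots r z a xs" and ys: "ys = insert_nth i a xs"
      by (auto simp: even_step_words_def)
    then have "ys \<in> permutations_of_set (insert a A)"
      using le permutations_of_set_insert_nth[OF assms(2)] by blast
    moreover have "even_steps r (ys @ [z])"
      using step[of xs i] xs i ys le by simp
    ultimately show "ys \<in> ?W (insert a A)"
      by (simp add: even_step_words_def)
  qed
  \<comment> \<open>Deleting \<open>a\<close> recovers the word; the position of \<open>a\<close>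
    then recovers the slot.\<close>
  moreover have "inj_on (\<lambda>(xs, i). insert_nth i a xs) ?D"
  proof (rule inj_onI, clarify)
    fix xs i ys j
    assume xs: "xs \<in> ?W A" "i \<in> slots r z a xs" and ys: "ys \<in> ?W A" "j \<in> slots r z a ys"
      and eq: "insert_nth i a xs = insert_nth j a ys"
    have notin: "a \<notin> set xs" "a \<notin> set ys"
      using W(1) xs(1) ys(1) assms(2) by auto
    then have "xs = ys"
      using remove1_insert_nth[of a xs i] remove1_insert_nth[of a ys j] eq by simp
    moreover have "i = j"
      using insert_nth_index_unique[of a xs i j] notin le xs(2) ys(2) eq \<open>xs = ys\<close> by simp
    ultimately show "xs = ys \<and> i = j" ..
  qed
  moreover have "card ?D = (\<Sum>xs\<in>?W A. card (slots r z a xs))"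
    by (rule card_SigmaI) (auto simp: even_step_words_def slots_def)
  moreover have "(\<Sum>xs\<in>?W A. card (slots r z a xs)) =
      (\<Sum>xs\<in>?W A. card {x \<in> A. odd x} + (if odd a \<or> r a z then 1 else 0))"
  proof (intro sum.cong refl)
    fix xs assume "xs \<in> ?W A"
    note xs = W[OF this]
    show "card (slots r z a xs) = card {x \<in> A. odd x} + (if odd a \<or> r a z then 1 else 0)"
      using card_slots[OF xs(2,3), of a] assms(5) unfolding xs(1) by blast
  qed
  ultimately show ?thesis
    by (simp add: card_image)
qed

section \<open>Closed forms for both orders\<close>

lemma even_step_words_empty: "even_step_words r z {} = {[]}"
  by (auto simp: even_step_words_def)

lemma card_odd_initial: "card {x \<in> {1..m}. odd x} = (m + 1) div 2"
proof (induction m)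
  case (Suc m)
  have "{x \<in> {1..Suc m}. odd x} =
      (if odd (Suc m) then insert (Suc m) {x \<in> {1..m}. odd x} else {x \<in> {1..m}. odd x})"
    by (auto simp: le_Suc_eq)
  with Suc show ?case by auto
qed simp

lemma card_odd_final:
  assumes "d \<le> 2 * n"
  shows "card {x \<in> {2 * n - d<..2 * n}. odd x} = d div 2"
  using assms
proof (induction d)
  case (Suc d)
  \<comment> \<open>The added element \<open>2 * n - d\<close> has the parity of
    \<open>d\<close>.\<close>
  have "{x \<in> {2 * n - Suc d<..2 * n}. odd x} =
      (if odd d then insert (2 * n - d) {x \<in> {2 * n - d<..2 * n}. odd x}
       else {x \<in> {2 * n - d<..2 * n}. odd x})"
    using Suc.prems by (auto; presburger)
  with Suc show ?case by auto
qed simp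

text \<open>Increasing insertion: the new letter exceeds all present ones but not \<open>z\<close>,
  so it cannot go last if it is even.\<close>

lemma card_greater_words:
  assumes "m < z"
  shows "card (even_step_words (>) z {1..m}) = fact (m div 2) * fact ((m + 1) div 2)"
  using assms
proof (induction m)
  case (Suc m)
  have "card (even_step_words (>) z {1..Suc m}) =
      (card {x \<in> {1..m}. odd x} + (if odd (Suc m) then 1 else 0)) *
       card (even_step_words (>) z {1..m})"
    using Suc.prems card_even_step_words_insert[of "{1..m}" "Suc m" "(>)" z]
    by (auto simp: atLeastAtMostSuc_conv)
  \<comment> \<open>For even \<open>m\<close> the open end adds the 1; for odd \<open>m\<close> the
    end is closed, but \<open>(m + 1) div 2\<close> already equals
    \<open>m div 2 + 1\<close>.\<close>
  also have "\<dots> = (m div 2 + 1) * (fact (m div 2) * fact ((m + 1) div 2))"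
    unfolding card_odd_initial using Suc by auto
  \<comment> \<open>The factor turns \<open>fact (m div 2)\<close> into
    \<open>fact ((Suc m + 1) div 2)\<close>, and the two factorials swap places.\<close>
  also have "\<dots> = fact (Suc m div 2) * fact ((Suc m + 1) div 2)"
    by (simp add: algebra_simps)
  finally show ?case .
qed (simp add: even_step_words_empty)

text \<open>Decreasing insertion: with \<open>d\<close> letters present, the new one
  \<open>2 * n - d\<close> is below them and below the sentinel, so the end is always open.\<close>

lemma card_less_words:
  assumes "d \<le> 2 * n"
  shows "card (even_step_words (<) (Suc (2 * n)) {2 * n - d<..2 * n}) =
    fact (d div 2) * fact ((d + 1) div 2)"
  using assms
proof (induction d)
  case (Suc d)
  have "{2 * n - Suc d<..2 * n} = insert (2 * n - d) {2 * n - d<..2 * n}"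
    using Suc.prems by auto
  then have "card (even_step_words (<) (Suc (2 * n)) {2 * n - Suc d<..2 * n}) =
      (card {x \<in> {2 * n - d<..2 * n}. odd x} + 1) *
       card (even_step_words (<) (Suc (2 * n)) {2 * n - d<..2 * n})"
    using card_even_step_words_insert[of "{2 * n - d<..2 * n}" "2 * n - d" "(<)" "Suc (2 * n)"]
    by (simp add: less_Suc_eq_le)
  also have "\<dots> = (d div 2 + 1) * (fact (d div 2) * fact ((d + 1) div 2))"
    using Suc card_odd_final[of d n] by simp
  also have "\<dots> = fact (Suc d div 2) * fact ((Suc d + 1) div 2)"
    by (simp add: algebra_simps)
  finally show ?case .
qed (simp add: even_step_words_empty)

section \<open>From even descents to steps with a sentinel\<close>

lemma even_steps_snoc_conv_nth:
  "even_steps r (xs @ [z]) \<longleftrightarrow>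
    (\<forall>i<length xs. even (xs ! i) \<longrightarrow> r (xs ! i) ((xs @ [z]) ! Suc i))"
  by (auto simp: successively_conv_nth nth_append)

text \<open>The step to the sentinel is never a descent, so adding it changes nothing and lets the
  index run over all letters.\<close>

lemma des_E_snoc:
  assumes "\<And>x. x \<in> set xs \<Longrightarrow> x < z"
  shows "des_E xs =
    card {i. i < length xs \<and> even (xs ! i) \<and> (xs @ [z]) ! Suc i < xs ! i}"
proof -
  have "\<not> z < xs ! i" if "i < length xs" for i
    using assms[of "xs ! i"] that by simp
  then show ?thesis
    unfolding des_E_def
    by (intro arg_cong[where f = card]) (auto simp: nth_append split: if_splits)
qed

text \<open>Neighbours differ by distinctness, and the last letter differs from the sentinel, so not
  descending means ascending.\<close>

lemma des_E_eq_0_iff: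
  assumes "distinct xs" "\<And>x. x \<in> set xs \<Longrightarrow> x < z"
  shows "des_E xs = 0 \<longleftrightarrow> even_steps (<) (xs @ [z])"
proof -
  have "(xs @ [z]) ! Suc i \<noteq> xs ! i" if "i < length xs" for i
  proof -
    have "xs ! i < z"
      using assms(2) that by simp
    then show ?thesis
      using assms(1) that by (auto simp: nth_append nth_eq_iff_index_eq)
  qed
  then have "(\<not> (xs @ [z]) ! Suc i < xs ! i) = (xs ! i < (xs @ [z]) ! Suc i)"
    if "i < length xs" for i
    using that by (metis linorder_neqE_nat order.asym)
  moreover have "des_E xs = 0 \<longleftrightarrow>
      (\<forall>i<length xs. even (xs ! i) \<longrightarrow> \<not> (xs @ [z]) ! Suc i < xs ! i)"
    using des_E_snoc[of xs z] assms(2) by auto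
  ultimately show ?thesis
    unfolding even_steps_snoc_conv_nth by blast
qed

text \<open>The descent positions counted lie among the positions of even letters, so equal counts
  mean equal sets. An even last letter violates both sides.\<close>

lemma des_E_eq_card_even_iff:
  assumes "distinct xs" "\<And>x. x \<in> set xs \<Longrightarrow> x < z"
  shows "des_E xs = card {x \<in> set xs. even x} \<longleftrightarrow> even_steps (>) (xs @ [z])"
proof -
  let ?D = "{i. i < length xs \<and> even (xs ! i) \<and> (xs @ [z]) ! Suc i < xs ! i}"
  let ?E = "{i. i < length xs \<and> even (xs ! i)}"
  have "finite ?E" "?D \<subseteq> ?E"
    by auto
  from card_subset_eq[OF this] have "card ?D = card ?E \<longleftrightarrow> ?D = ?E"
    by (rule iffI) (assumption, erule arg_cong)
  moreover have "card ?E = card {x \<in> set xs. even x}"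
    by (rule card_nth_filter[OF assms(1)])
  moreover have "des_E xs = card ?D"
    using assms(2) by (rule des_E_snoc)
  ultimately have "des_E xs = card {x \<in> set xs. even x} \<longleftrightarrow> ?D = ?E"
    by argo
  then show ?thesis
    unfolding even_steps_snoc_conv_nth by blast
qed

theorem theorem3p3:
  fixes n :: nat
  assumes "n \<ge> 1"
  shows "R 0 (2 * n) = (fact n)\<^sup>2 \<and> R n (2 * n) = (fact n)\<^sup>2"
proof -
  have word: "distinct xs" "set xs = {1..2 * n}" "\<And>x. x \<in> set xs \<Longrightarrow> x < Suc (2 * n)"
    if "xs \<in> permutations_of_set {1..2 * n}" for xs
    using that by (auto simp: permutations_of_set_def)
  have diff: "{x \<in> {1..2 * n}. even x} = {1..2 * n} - {x \<in> {1..2 * n}. odd x}"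
    by auto
  \<comment> \<open>Thus the value \<open>n\<close> of \<open>des_E\<close> is the case where every
    even letter is a descent top.\<close>
  have evens: "card {x \<in> {1..2 * n}. even x} = n"
    using card_odd_initial[of "2 * n"]
    by (subst diff, subst card_Diff_subset) auto
  have "R 0 (2 * n) = card (even_step_words (<) (Suc (2 * n)) {1..2 * n})"
    unfolding R_def even_step_words_def
    using des_E_eq_0_iff[OF word(1,3)]
    by (intro arg_cong[where f = card] Collect_cong conj_cong) auto
  \<comment> \<open>The whole interval is the top segment for \<open>d = 2 * n\<close>.\<close>
  also have "{1..2 * n} = {2 * n - 2 * n<..2 * n}"
    by auto
  also have "card (even_step_words (<) (Suc (2 * n)) \<dots>) = (fact n)\<^sup>2"
    by (subst card_less_words) (simp_all add: power2_eq_square)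
  finally have "R 0 (2 * n) = (fact n)\<^sup>2" .
  moreover have "R n (2 * n) = card (even_step_words (>) (Suc (2 * n)) {1..2 * n})"
    unfolding R_def even_step_words_def
    using des_E_eq_card_even_iff[OF word(1,3)] word(2) evens
    by (intro arg_cong[where f = card] Collect_cong conj_cong) auto
  then have "R n (2 * n) = (fact n)\<^sup>2"
    by (simp add: card_greater_words power2_eq_square del: One_nat_def)
  ultimately show ?thesis ..
qed

end
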